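(* Let $d\ge 1$ be an integer and let $\chi$ be a Poisson point process on $\mathbb{R}^d$ whose intensity measure is Lebesgue measure. There exists $\alpha_0>0$ such that for every appetite $\alpha\in(0,\alpha_0)$ and every $s>0$, $E(D^s)$ is finite, where $D$ is the diameter of the connected component containing the origin of the closure $\mathcal{C}$ of the union of all territories in the stable allocation of $\mathbb{R}^d$ to $\chi$ with appetite $\alpha$.
   Context: $|\cdot|$ is Lebesgue measure on $\mathbb{R}^d$ and $\|\cdot\|$ the Euclidean norm. Let $\chi$ be a locally finite subset of $\mathbb{R}^d$; its elements are called centers and elements of $\mathbb{R}^d$ are called sites. Let $\alpha\in(0,\infty)$ (the appetite). An allocation of $\mathbb{R}^d$ to $\chi$ with appetite $\alpha$ is a measurable function $\psi:\mathbb{R}^d\to\chi\cup\{\infty,\Delta\}$ such that $|\psi^{-1}(\Delta)|=0$ and $|\psi^{-1}(a)|\le\alpha$ for all $a\in\chi$. The set $\psi^{-1}(a)$ is the territory of the center $a$. A center $a$ is sated if $|\psi^{-1}(a)|=\alpha$ and unsated otherwise. A site $x$ is claimed if $\psi(x)\in\chi$ and unclaimed if $\psi(x)=\infty$. Let $a$ be a center and $x$ a site with $\psi(x)\notin\{a,\Delta\}$. We say $x$ desires $a$ if $\|x-a\|<\|x-\psi(x)\|$ or $x$ is unclaimed. We say $a$ covets $x$ if $\|x-a\|<\|x'-a\|$ for some $x'\in\psi^{-1}(a)$, or $a$ is unsated. The pair $(x,a)$ is unstable if $x$ desires $a$ and $a$ covets $x$. An allocation is stable if there are no unstable pairs. It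 is known (Hoffman, Holroyd, Peres) that for $\chi$ a Poisson point process with intensity Lebesgue measure, almost surely there exists a $|\cdot|$-a.e. unique stable allocation $\psi$ from $\mathbb{R}^d$ to $\chi$ with appetite $\alpha$. Set $\mathcal{C}=\overline{\psi^{-1}(\chi)}$, the closure of the union of all territories. The diameter is Euclidean ($D=0$ if the origin is not in $\mathcal{C}$). Measurability of $D$ is not part of the claim: finiteness of $E(D^s)$ is understood as $D^s$ being bounded above by an integrable random variable. *)

theory Defs
  imports "HOL-Probability.Probability"
begin

definition locally_finite_set :: "'a::metric_space set \<Rightarrow> bool" where
  "locally_finite_set \<Xi> \<longleftrightarrow> (\<forall>B. bounded B \<longrightarrow> finite (\<Xi> \<inter> B))"

text \<open>
  A Poisson point process with intensity Lebesgue measure, as a random locally finite set of points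
  (Lebesgue measure has no atoms, so the process is simple and multiplicities are not needed).
  The distribution of the counts is written out because the library's
  \<open>poisson_pmf\<close> is only specified for positive rates, while here the volume of \<open>B\<close> may be zero.
\<close>

definition poisson_point_process ::
    "'w measure \<Rightarrow> ('w \<Rightarrow> 'a::euclidean_space set) \<Rightarrow> bool" where
  "poisson_point_process M X \<longleftrightarrow>
     prob_space M \<and>
     (\<forall>\<omega>\<in>space M. locally_finite_set (X \<omega>)) \<and>
     (\<forall>B. B \<in> sets borel \<and> bounded B \<longrightarrow>
        (\<lambda>\<omega>. card (X \<omega> \<inter> B)) \<in> measurable M (count_space UNIV) \<and>
        (\<forall>k. measure M {\<omega> \<in> space M. card (X \<omega> \<inter> B) = k} =
             measure lborel B ^ k / fact k * exp (- measure lborel B))) \<and>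
     (\<forall>\<B>. finite \<B> \<and> disjoint \<B> \<and> (\<forall>B\<in>\<B>. B \<in> sets borel \<and> bounded B) \<longrightarrow>
        prob_space.indep_vars M (\<lambda>_. count_space UNIV) (\<lambda>B \<omega>. card (X \<omega> \<inter> B)) \<B>)"

text \<open>
  The values of an allocation: a center, \<open>\<infinity>\<close> (\<open>Unclaimed\<close>) or \<open>\<Delta>\<close> (\<open>Undecided\<close>).
\<close>

datatype 'a site_value = Center 'a | Unclaimed | Undecided

definition territory :: "('a \<Rightarrow> 'a site_value) \<Rightarrow> 'a \<Rightarrow> 'a set" where
  "territory \<psi> a = \<psi> -` {Center a}"

text \<open>
  Since \<open>\<Xi>\<close> is countable, its discrete sigma-algebra is the only sensible one on the target;
  membership in \<open>measurable\<close> also says that \<open>\<psi>\<close> takes values in the target set.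
  Sites are measured by (complete) Lebesgue measure.
\<close>

definition allocation ::
    "'a::euclidean_space set \<Rightarrow> real \<Rightarrow> ('a \<Rightarrow> 'a site_value) \<Rightarrow> bool" where
  "allocation \<Xi> \<alpha> \<psi> \<longleftrightarrow>
     \<psi> \<in> measurable lebesgue (count_space (Center ` \<Xi> \<union> {Unclaimed, Undecided})) \<and>
     emeasure lebesgue (\<psi> -` {Undecided}) = 0 \<and>
     (\<forall>a\<in>\<Xi>. emeasure lebesgue (territory \<psi> a) \<le> ennreal \<alpha>)"

definition sated :: "real \<Rightarrow> ('a::euclidean_space \<Rightarrow> 'a site_value) \<Rightarrow> 'a \<Rightarrow> bool" where
  "sated \<alpha> \<psi> a \<longleftrightarrow> emeasure lebesgue (territory \<psi> a) = ennreal \<alpha>"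

definition desires :: "('a::euclidean_space \<Rightarrow> 'a site_value) \<Rightarrow> 'a \<Rightarrow> 'a \<Rightarrow> bool" where
  "desires \<psi> x a \<longleftrightarrow>
     \<psi> x \<notin> {Center a, Undecided} \<and>
     ((\<exists>b. \<psi> x = Center b \<and> norm (x - a) < norm (x - b)) \<or> \<psi> x = Unclaimed)"

definition covets :: "real \<Rightarrow> ('a::euclidean_space \<Rightarrow> 'a site_value) \<Rightarrow> 'a \<Rightarrow> 'a \<Rightarrow> bool" where
  "covets \<alpha> \<psi> a x \<longleftrightarrow>
     \<psi> x \<notin> {Center a, Undecided} \<and>
     ((\<exists>x'\<in>territory \<psi> a. norm (x - a) < norm (x' - a)) \<or> \<not> sated \<alpha> \<psi> a)"

definition stable_allocation ::
    "'a::euclidean_space set \<Rightarrow> real \<Rightarrow> ('a \<Rightarrow> 'a site_value) \<Rightarrow> bool" where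
  "stable_allocation \<Xi> \<alpha> \<psi> \<longleftrightarrow>
     allocation \<Xi> \<alpha> \<psi> \<and> \<not> (\<exists>x. \<exists>a\<in>\<Xi>. desires \<psi> x a \<and> covets \<alpha> \<psi> a x)"

definition claimed_closure ::
    "'a::euclidean_space set \<Rightarrow> ('a \<Rightarrow> 'a site_value) \<Rightarrow> 'a set" where
  "claimed_closure \<Xi> \<psi> = closure (\<psi> -` (Center ` \<Xi>))"

text \<open>Empty, hence of diameter 0, if the origin is not in the closure.\<close>

definition origin_component ::
    "'a::euclidean_space set \<Rightarrow> ('a \<Rightarrow> 'a site_value) \<Rightarrow> 'a set" where
  "origin_component \<Xi> \<psi> = connected_component_set (claimed_closure \<Xi> \<psi>) 0"

end

theory Submission
  imports Defs "HOL-Real_Asymp.Real_Asymp"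
begin

text \<open>
  If a center \<open>a\<close> owns a site at distance \<open>r\<close>, stability forces the whole ball of radius \<open>r\<close> about \<open>a\<close>
  to be claimed by centers within distance \<open>2 * r\<close> of \<open>a\<close>; for a small appetite this ball of radius
  \<open>2 * r\<close> is then far more crowded than a Poisson process allows. A point of the component of
  the origin is joined to the origin by finitely many such crowded balls. A disjoint subfamily of them,
  found by the Vitali covering lemma, shows that the connected set of grid cells which they meet
  contains at least a fixed multiple of its size in centers. Such a set of \<open>k + 1\<close> cells is
  traced by a walk of length \<open>2 * k\<close>, so a union bound over walks against the Poisson tail makes its
  existence exponentially unlikely in \<open>k\<close> once the grid is fine enough.
\<close>

subsection \<open>Grid cells and walks\<close>

text \<open>For positive \<open>\<rho>\<close> a cell is a half-open cube of side
  \<open>\<rho>\<close>, named by an integer vector of the space itself, so that cells can be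
  subtracted and walks are sums of steps.\<close>

definition cell :: "real \<Rightarrow> 'a::euclidean_space \<Rightarrow> 'a" where
  "cell \<rho> x = (\<Sum>b\<in>Basis. of_int \<lfloor>x \<bullet> b / \<rho>\<rfloor> *\<^sub>R b)"

text \<open>The moves of a chess king, rest included: nearby points may differ in every coordinate
  of their cells, so cells touching at a corner count as neighbours.\<close>

definition king_steps :: "'a::euclidean_space set" where
  "king_steps = {v. \<forall>b\<in>Basis. v \<bullet> b \<in> {-1, 0, 1}}"

text \<open>A walk is a start and a list of steps, so that walks of a given length from 0 are lists
  over a finite alphabet and easy to count.\<close>

fun visited :: "'a::monoid_add \<Rightarrow> 'a list \<Rightarrow> 'a set" where
  "visited z [] = {z}"
| "visited z (s # w) = insert z (visited (z + s) w)"

lemma start_in_visited: "z \<in> visited z w"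
  by (cases w) auto

lemma finite_visited: "finite (visited z w)"
  by (induction w arbitrary: z) auto

lemma card_visited_le: "card (visited z w) \<le> length w + 1"
proof (induction w arbitrary: z)
  case (Cons s w)
  then show ?case
    using card_insert_le_m1[of "length w + 2" "visited (z + s) w" z] by simp
qed simp

lemma visited_append: "visited z (u @ v) = visited z u \<union> visited (z + sum_list u) v"
  by (induction u arbitrary: z) (auto simp: add.assoc start_in_visited)

lemma visited_split:
  assumes "y \<in> visited z w"
  obtains u v where "w = u @ v" "y = z + sum_list u"
  using assms
proof (induction w arbitrary: z thesis)
  case Nil
  then show ?case by force
next
  case (Cons s w)
  show ?case
  proof (cases "y = z")
    case True
    then show ?thesis using Cons.prems(1)[of "[]" "s # w"] by simp
  next
    case False
    then have "y \<in> visited (z + s) w" using Cons.prems by simp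
    then obtain u v where "w = u @ v" "y = z + s + sum_list u"
      using Cons.IH by blast
    then show ?thesis using Cons.prems(1)[of "s # u" v] by (simp add: add.assoc)
  qed
qed

text \<open>Stepping to \<open>y + s\<close> and straight back ends at \<open>y\<close> again, so
  the remainder \<open>v\<close> of the walk visits what it visited before.\<close>

lemma visited_detour:
  fixes z :: "'a::ab_group_add"
  assumes "w = u @ v" "y = z + sum_list u"
  shows "visited z (u @ [s, - s] @ v) = insert (y + s) (visited z w)"
  using assms by (auto simp: visited_append start_in_visited)

lemma finite_king_steps: "finite (king_steps :: 'a::euclidean_space set)"
proof -
  have "(king_steps :: 'a set) \<subseteq> (\<lambda>f. \<Sum>b\<in>Basis. f b *\<^sub>R b) ` (Basis \<rightarrow>\<^sub>E {-1, 0, 1})"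
  proof
    fix v :: 'a
    assume v: "v \<in> king_steps"
    have "v = (\<Sum>b\<in>Basis. restrict (\<lambda>b. v \<bullet> b) Basis b *\<^sub>R b)"
      by (simp add: euclidean_representation)
    then show "v \<in> (\<lambda>f. \<Sum>b\<in>Basis. f b *\<^sub>R b) ` (Basis \<rightarrow>\<^sub>E {-1, 0, 1})"
      using v by (intro image_eqI[where x = "restrict (\<lambda>b. v \<bullet> b) Basis"])
        (auto simp: king_steps_def)
  qed
  then show ?thesis
    by (rule finite_subset) (intro finite_imageI finite_PiE, auto)
qed

lemma king_steps_uminus: "v \<in> king_steps \<Longrightarrow> - v \<in> king_steps"
  by (auto simp: king_steps_def)

lemma zero_king_step: "0 \<in> king_steps"
  by (simp add: king_steps_def)

lemma visited_coordinate_bound: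
  assumes "set w \<subseteq> king_steps" "y \<in> visited z w" "b \<in> Basis"
  shows "\<bar>(y - z) \<bullet> b\<bar> \<le> length w"
  using assms
proof (induction w arbitrary: z)
  case (Cons s w)
  have s: "\<bar>s \<bullet> b\<bar> \<le> 1" using Cons.prems by (auto simp: king_steps_def)
  show ?case
  proof (cases "y = z")
    case False
    then have "\<bar>(y - (z + s)) \<bullet> b\<bar> \<le> length w" using Cons by simp
    then show ?thesis using s by (simp add: inner_diff_left inner_add_left)
  qed simp
qed simp

section \<open>Geometry of cells: adjacency, measurability, volume and counting\<close>

lemma cell_inner: "b \<in> Basis \<Longrightarrow> cell \<rho> x \<bullet> b = of_int \<lfloor>x \<bullet> b / \<rho>\<rfloor>"
  by (simp add: cell_def)

lemma cell_0 [simp]: "cell \<rho> 0 = 0"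
  by (simp add: cell_def)

lemma floor_diff_less_1:
  fixes s t :: real
  assumes "\<bar>s - t\<bar> < 1"
  shows "real_of_int \<lfloor>s\<rfloor> - of_int \<lfloor>t\<rfloor> \<in> {-1, 0, 1}"
proof -
  have "\<lfloor>s\<rfloor> - \<lfloor>t\<rfloor> \<in> {-1, 0, 1}" using assms by (simp, linarith)
  then have "real_of_int (\<lfloor>s\<rfloor> - \<lfloor>t\<rfloor>) \<in> real_of_int ` {-1, 0, 1}" by (rule imageI)
  then show ?thesis by simp
qed

text \<open>No coordinate changes by more than the distance, which is less than the side of a
  cell.\<close>

lemma cell_diff_king_step:
  assumes "\<rho> > 0" "dist x y < \<rho>"
  shows "cell \<rho> y - cell \<rho> x \<in> king_steps"
  unfolding king_steps_def
proof (intro CollectI ballI)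
  fix b :: 'a
  assume b: "b \<in> Basis"
  have "\<bar>y \<bullet> b - x \<bullet> b\<bar> < \<rho>"
    using Basis_le_norm[OF b, of "y - x"] assms(2)
    by (simp add: inner_diff_left dist_norm norm_minus_commute)
  then have "\<bar>y \<bullet> b / \<rho> - x \<bullet> b / \<rho>\<bar> < 1"
    using assms(1) by (simp add: diff_divide_distrib[symmetric] abs_divide)
  then show "(cell \<rho> y - cell \<rho> x) \<bullet> b \<in> {-1, 0, 1}"
    using floor_diff_less_1 b by (simp add: inner_diff_left cell_inner)
qed

lemma cell_measurable [measurable]: "cell \<rho> \<in> borel_measurable borel"
  unfolding cell_def by measurable

lemma cell_preimage_measurable:
  assumes "finite V" shows "cell \<rho> -` V \<in> sets borel"
  using measurable_sets[OF cell_measurable, of V \<rho>] assms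
  by (simp add: borel_closed finite_imp_closed)

lemma cell_preimage_singleton_subset:
  fixes z :: "'a::euclidean_space"
  assumes "\<rho> > 0"
  shows "cell \<rho> -` {z} \<subseteq> cbox (\<rho> *\<^sub>R z) (\<rho> *\<^sub>R z + \<rho> *\<^sub>R One)"
proof
  fix x
  assume "x \<in> cell \<rho> -` {z}"
  then have "z \<bullet> b = of_int \<lfloor>x \<bullet> b / \<rho>\<rfloor>" if "b \<in> Basis" for b
    using cell_inner[OF that, of \<rho> x] by simp
  then have "z \<bullet> b \<le> x \<bullet> b / \<rho> \<and> x \<bullet> b / \<rho> \<le> z \<bullet> b + 1" if "b \<in> Basis" for b
    using that by simp
  then show "x \<in> cbox (\<rho> *\<^sub>R z) (\<rho> *\<^sub>R z + \<rho> *\<^sub>R One)"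
    using assms by (auto simp: mem_box inner_add_left field_simps)
qed

lemma cell_preimage_bounded:
  fixes V :: "'a::euclidean_space set"
  assumes "\<rho> > 0" "finite V"
  shows "bounded (cell \<rho> -` V)"
proof -
  have "bounded (cell \<rho> -` {z})" for z :: 'a
    by (rule bounded_subset[OF bounded_cbox cell_preimage_singleton_subset[OF assms(1)]])
  then have "bounded (\<Union>z\<in>V. cell \<rho> -` {z})" using assms(2) by blast
  then show ?thesis by (simp add: vimage_eq_UN[symmetric])
qed

text \<open>Cells lie in cubes of side \<open>\<rho>\<close>. This will bound the mean of the
  Poisson count over the cells of a walk.\<close>

lemma measure_cell_preimage_le:
  fixes \<rho> :: real and V :: "'a::euclidean_space set"
  assumes "\<rho> > 0" "finite V"
  shows "measure lborel (cell \<rho> -` V) \<le> card V * \<rho> ^ DIM('a)"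
proof -
  have fin: "emeasure lborel (cell \<rho> -` W) < \<infinity>" if "finite W" for W :: "'a set"
    by (intro emeasure_bounded_finite cell_preimage_bounded assms that)
  have one: "measure lborel (cell \<rho> -` {z}) \<le> \<rho> ^ DIM('a)" for z :: 'a
  proof -
    have "measure lborel (cell \<rho> -` {z}) \<le> measure lborel (cbox (\<rho> *\<^sub>R z) (\<rho> *\<^sub>R z + \<rho> *\<^sub>R One))"
      using cell_preimage_singleton_subset[OF assms(1)] cell_preimage_measurable[of "{z}" \<rho>]
      by (intro measure_mono_fmeasurable) auto
    also have "\<dots> = \<rho> ^ DIM('a)"
      using assms(1) by (simp add: measure_lborel_cbox_eq inner_add_left)
    finally show ?thesis .
  qed
  have "cell \<rho> -` V = (\<Union>z\<in>V. cell \<rho> -` {z})" by blast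
  then have "measure lborel (cell \<rho> -` V) \<le> (\<Sum>z\<in>V. measure lborel (cell \<rho> -` {z}))"
    using assms(2) cell_preimage_measurable[of "{_}" \<rho>] by (auto intro!: measure_UNION_le)
  also have "\<dots> \<le> (\<Sum>z\<in>V. \<rho> ^ DIM('a))" using one by (rule sum_mono)
  finally show ?thesis by simp
qed

lemma card_int_interval_le:
  fixes c R :: real
  assumes "R \<ge> 0"
  shows "finite {z. \<bar>of_int z - c\<bar> \<le> R}" "card {z. \<bar>of_int z - c\<bar> \<le> R} \<le> 2 * R + 1"
proof -
  have eq: "{z. \<bar>of_int z - c\<bar> \<le> R} = {\<lceil>c - R\<rceil>..\<lfloor>c + R\<rfloor>}"
    by (auto simp: ceiling_le_iff le_floor_iff abs_le_iff)
  show "finite {z. \<bar>of_int z - c\<bar> \<le> R}" by (simp add: eq)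
  have "real_of_int (\<lfloor>c + R\<rfloor> - \<lceil>c - R\<rceil> + 1) \<le> 2 * R + 1" by simp linarith
  then show "card {z. \<bar>of_int z - c\<bar> \<le> R} \<le> 2 * R + 1"
    using assms unfolding eq by simp
qed

text \<open>In each coordinate the cells vary over an interval of length \<open>20 * r / \<rho> + 2 \<le> 22 * (r / \<rho>)\<close>.\<close>

lemma card_cell_ball_le:
  fixes a :: "'a::euclidean_space"
  assumes "\<rho> > 0" "r \<ge> \<rho>"
  shows "finite (cell \<rho> ` ball a (10 * r))"
    "card (cell \<rho> ` ball a (10 * r)) \<le> 23 ^ DIM('a) * (r / \<rho>) ^ DIM('a)"
proof -
  define R where "R = 10 * r / \<rho> + 1"
  define I where "I = (\<lambda>b. {z. \<bar>of_int z - a \<bullet> b / \<rho>\<bar> \<le> R})"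
  define g where "g = (\<lambda>f. \<Sum>b\<in>Basis. of_int (f b) *\<^sub>R b :: 'a)"
  have one: "r / \<rho> \<ge> 1" using assms by simp
  \<comment> \<open>\<open>2 * R + 1\<close> bounds the number of integers available per coordinate.
    It equals \<open>20 * r / \<rho> + 3\<close>, and \<open>r / \<rho>\<close> is at least
    1.\<close>
  have R: "R \<ge> 0" "2 * R + 1 \<le> 23 * (r / \<rho>)" using one unfolding R_def by auto
  have fin: "finite (Pi\<^sub>E Basis I)"
    unfolding I_def by (intro finite_PiE) (auto intro: card_int_interval_le R)
  have sub: "cell \<rho> ` ball a (10 * r) \<subseteq> g ` Pi\<^sub>E Basis I"
  proof
    fix z assume "z \<in> cell \<rho> ` ball a (10 * r)"
    then obtain x where x: "dist a x < 10 * r" "z = cell \<rho> x" by auto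
    have "\<lfloor>x \<bullet> b / \<rho>\<rfloor> \<in> I b" if b: "b \<in> Basis" for b
    proof -
      have "\<bar>x \<bullet> b - a \<bullet> b\<bar> \<le> 10 * r"
        using Basis_le_norm[OF b, of "x - a"] x(1)
        by (simp add: inner_diff_left dist_norm norm_minus_commute)
      then have "\<bar>x \<bullet> b - a \<bullet> b\<bar> / \<rho> \<le> 10 * r / \<rho>"
        using assms(1) by (intro divide_right_mono) auto
      then have "\<bar>x \<bullet> b / \<rho> - a \<bullet> b / \<rho>\<bar> \<le> 10 * r / \<rho>"
        using assms(1) by (simp add: diff_divide_distrib[symmetric] abs_divide)
      then show ?thesis unfolding I_def R_def by simp linarith
    qed
    then have "restrict (\<lambda>b. \<lfloor>x \<bullet> b / \<rho>\<rfloor>) Basis \<in> Pi\<^sub>E Basis I" by auto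
    moreover have "z = g (restrict (\<lambda>b. \<lfloor>x \<bullet> b / \<rho>\<rfloor>) Basis)"
      unfolding g_def x(2) cell_def by (rule sum.cong) auto
    ultimately show "z \<in> g ` Pi\<^sub>E Basis I" by blast
  qed
  show "finite (cell \<rho> ` ball a (10 * r))" using sub fin finite_subset by blast
  have "card (cell \<rho> ` ball a (10 * r)) \<le> card (Pi\<^sub>E Basis I)"
    using surj_card_le[OF fin sub] .
  also have "\<dots> = (\<Prod>b\<in>Basis. card (I b))" by (rule card_PiE) simp
  finally have "real (card (cell \<rho> ` ball a (10 * r))) \<le> real (\<Prod>b\<in>Basis. card (I b))" by (simp only: of_nat_le_iff)
  also have "\<dots> = (\<Prod>b\<in>Basis. real (card (I b)))" by simp
  also have "\<dots> \<le> (\<Prod>b\<in>(Basis::'a set). 23 * (r / \<rho>))"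
    unfolding I_def using card_int_interval_le(2)[OF R(1)] R(2)
    by (intro prod_mono conjI) (auto intro: order_trans)
  also have "\<dots> = 23 ^ DIM('a) * (r / \<rho>) ^ DIM('a)" by (simp add: power_mult_distrib power_divide)
  finally show "card (cell \<rho> ` ball a (10 * r)) \<le> 23 ^ DIM('a) * (r / \<rho>) ^ DIM('a)" .
qed

text \<open>Each new cell costs two steps, as it is inserted into the walk by a detour.\<close>

lemma walk_visiting_cells:
  fixes U :: "'a::euclidean_space set"
  assumes \<rho>: "\<rho> > 0" and U: "connected U" "0 \<in> U" and fin: "finite (cell \<rho> ` U)"
  obtains w where "set w \<subseteq> king_steps" "length w = 2 * (card (cell \<rho> ` U) - 1)"
    "visited 0 w = cell \<rho> ` U"
proof -
  let ?A = "cell \<rho> ` U"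
  have "\<exists>w. set w \<subseteq> king_steps \<and> length w = 2 * k \<and> visited 0 w \<subseteq> ?A \<and> card (visited 0 w) = k + 1"
    if "k < card ?A" for k
    using that
  proof (induction k)
    case 0
    have "0 \<in> ?A" using U(2) by (metis cell_0 imageI)
    then show ?case by (intro exI[of _ "[]"]) auto
  next
    case (Suc k)
    then obtain w where w: "set w \<subseteq> king_steps" "length w = 2 * k" "visited 0 w \<subseteq> ?A"
      "card (visited 0 w) = k + 1" by auto
    \<comment> \<open>Otherwise lying in a visited cell is locally constant on \<open>U\<close>,
      because points of a ball of radius \<open>\<rho>/2\<close> lie in equal or neighbouring cells.
      Connectedness then spreads it from 0 to all of \<open>U\<close>, but only \<open>k + 1\<close>
      cells are visited and \<open>?A\<close> has more.\<close>
    have "\<exists>z\<in>visited 0 w. \<exists>y\<in>?A - visited 0 w. y - z \<in> king_steps"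
    proof (rule ccontr)
      assume neg: "\<not> ?thesis"
      have "cell \<rho> x \<in> visited 0 w" if "x \<in> U" for x
        using U(1,2) that
      proof (rule connected_induction_simple[where P = "\<lambda>x. cell \<rho> x \<in> visited 0 w"])
        show "cell \<rho> 0 \<in> visited 0 w" by (simp add: start_in_visited)
        fix x assume x: "x \<in> U"
        have "cell \<rho> z \<in> visited 0 w"
          if "y \<in> U \<inter> ball x (\<rho>/2)" "z \<in> U \<inter> ball x (\<rho>/2)" "cell \<rho> y \<in> visited 0 w" for y z
        proof -
          have "dist y z < \<rho>"
            using that dist_triangle_half_r[of x y \<rho> z] by auto
          then have "cell \<rho> z - cell \<rho> y \<in> king_steps" by (rule cell_diff_king_step[OF \<rho>])
          moreover have "cell \<rho> z \<in> ?A" using that(2) by blast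
          ultimately show ?thesis using neg that(3) by blast
        qed
        moreover have "openin (top_of_set U) (U \<inter> ball x (\<rho>/2))" "x \<in> U \<inter> ball x (\<rho>/2)"
          using x \<rho> by auto
        ultimately show "\<exists>T. openin (top_of_set U) T \<and> x \<in> T \<and>
            (\<forall>y\<in>T. \<forall>z\<in>T. cell \<rho> y \<in> visited 0 w \<longrightarrow> cell \<rho> z \<in> visited 0 w)"
          by blast
      qed
      then have "?A \<subseteq> visited 0 w" by blast
      then have "card ?A \<le> k + 1" using w(4) card_mono[OF finite_visited] by metis
      then show False using Suc.prems by simp
    qed
    then obtain z y where zy: "z \<in> visited 0 w" "y \<in> ?A" "y \<notin> visited 0 w" "y - z \<in> king_steps"
      by blast
    from visited_split[OF zy(1)] obtain u v where uv: "w = u @ v" "z = 0 + sum_list u" .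
    have "z + (y - z) = y" by simp
    then have vis: "visited 0 (u @ [y - z, - (y - z)] @ v) = insert y (visited 0 w)"
      using visited_detour[OF uv, of "y - z"] by argo
    show ?case
    proof (rule exI[of _ "u @ [y - z, - (y - z)] @ v"], intro conjI)
      show "set (u @ [y - z, - (y - z)] @ v) \<subseteq> king_steps"
        using w(1) uv(1) zy(4) king_steps_uminus[OF zy(4)] by auto
      show "length (u @ [y - z, - (y - z)] @ v) = 2 * Suc k" using w(2) uv(1) by simp
      show "visited 0 (u @ [y - z, - (y - z)] @ v) \<subseteq> ?A" unfolding vis using w(3) zy(2) by blast
      show "card (visited 0 (u @ [y - z, - (y - z)] @ v)) = Suc k + 1"
        unfolding vis using w(4) zy(3) by (simp add: finite_visited)
    qed
  qed
  moreover have "card ?A > 0" using U(2) fin by (auto simp: card_gt_0_iff)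
  ultimately obtain w where w: "set w \<subseteq> king_steps" "length w = 2 * (card ?A - 1)"
    "visited 0 w \<subseteq> ?A" "card (visited 0 w) = card ?A - 1 + 1"
    by (metis diff_less zero_less_one)
  have "visited 0 w = ?A"
    using w(3,4) \<open>card ?A > 0\<close> by (intro card_subset_eq fin) auto
  then show ?thesis using that w by blast
qed

subsection \<open>Crowded balls in a stable allocation\<close>

text \<open>Up to a constant, \<open>(r / \<rho>) ^ DIM('a)\<close> is the number of cells met by
  the ball. The lower bound on \<open>r\<close> is what makes this count valid, as a tiny ball still
  meets a whole cell.\<close>

definition crowded :: "real \<Rightarrow> 'a::euclidean_space set \<Rightarrow> 'a \<Rightarrow> real \<Rightarrow> bool" where
  "crowded \<rho> \<Xi> a r \<longleftrightarrow> \<rho> \<le> r \<and> (r / \<rho>) ^ DIM('a) \<le> card (\<Xi> \<inter> ball a (2 * r))"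

text \<open>
  Every site nearer to \<open>a\<close> than some site of its territory is coveted by \<open>a\<close>, so by stability
  it is claimed by a center at least as near, which therefore lies in the concentric ball of
  twice the radius.
\<close>

lemma stable_ball_volume_le:
  fixes \<Xi> :: "'a::euclidean_space set"
  assumes stable: "stable_allocation \<Xi> \<alpha> \<psi>" and lf: "locally_finite_set \<Xi>" and \<alpha>: "0 \<le> \<alpha>"
    and a: "a \<in> \<Xi>" and x: "x \<in> territory \<psi> a"
  shows "unit_ball_vol DIM('a) * dist a x ^ DIM('a) \<le> \<alpha> * card (\<Xi> \<inter> ball a (2 * dist a x))"
proof -
  define r where "r = dist a x"
  define C where "C = \<Xi> \<inter> ball a (2 * r)"
  have fin: "finite C" using lf unfolding locally_finite_set_def C_def by simp
  from stable have meas: "\<psi> \<in> measurable lebesgue (count_space (Center ` \<Xi> \<union> {Unclaimed, Undecided}))"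
    and null: "emeasure lebesgue (\<psi> -` {Undecided}) = 0"
    and app: "\<And>b. b \<in> \<Xi> \<Longrightarrow> emeasure lebesgue (territory \<psi> b) \<le> ennreal \<alpha>"
    and unstable: "\<And>y. \<not> (desires \<psi> y a \<and> covets \<alpha> \<psi> a y)"
    using a unfolding stable_allocation_def allocation_def by blast+
  have sets: "\<psi> -` {v} \<in> sets lebesgue" if "v \<in> Center ` \<Xi> \<union> {Unclaimed, Undecided}" for v
    using measurable_sets[OF meas, of "{v}"] that by simp
  have sub: "ball a r \<subseteq> \<psi> -` {Undecided} \<union> (\<Union>b\<in>C. territory \<psi> b)"
  proof
    fix y assume y: "y \<in> ball a r"
    have dist_y: "norm (y - a) < r" using y by (simp add: dist_norm norm_minus_commute)
    have val: "\<psi> y \<in> Center ` \<Xi> \<union> {Unclaimed, Undecided}"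
      using measurable_space[OF meas, of y] by simp
    show "y \<in> \<psi> -` {Undecided} \<union> (\<Union>b\<in>C. territory \<psi> b)"
    proof (cases "\<psi> y \<in> {Center a, Undecided}")
      case True
      moreover have "a \<in> C" using a le_less_trans[OF norm_ge_zero dist_y] by (simp add: C_def)
      ultimately show ?thesis by (auto simp: territory_def)
    next
      case False
      have "covets \<alpha> \<psi> a y"
        using False x dist_y unfolding covets_def r_def
        by (auto simp: dist_norm norm_minus_commute)
      then have "\<not> desires \<psi> y a" using unstable by blast
      then obtain b where b: "\<psi> y = Center b" "norm (y - b) \<le> norm (y - a)" "b \<in> \<Xi>"
        using False val unfolding desires_def by (auto simp: not_less)
      have "dist a b \<le> dist a y + dist y b" by (rule dist_triangle)
      also have "\<dots> < 2 * r" using b(2) dist_y by (simp add: dist_norm norm_minus_commute)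
      finally have "b \<in> C" using b(3) by (simp add: C_def)
      then show ?thesis using b(1) by (auto simp: territory_def)
    qed
  qed
  have terr: "territory \<psi> b \<in> sets lebesgue" if "b \<in> C" for b
    using sets[of "Center b"] that by (auto simp: territory_def C_def)
  have "ennreal (unit_ball_vol DIM('a) * r ^ DIM('a)) = emeasure lebesgue (ball a r)"
    by (simp add: emeasure_ball r_def)
  also have "\<dots> \<le> emeasure lebesgue (\<psi> -` {Undecided} \<union> (\<Union>b\<in>C. territory \<psi> b))"
    using sub terr sets fin by (intro emeasure_mono sets.Un sets.finite_UN) auto
  also have "\<dots> \<le> emeasure lebesgue (\<psi> -` {Undecided}) + emeasure lebesgue (\<Union>b\<in>C. territory \<psi> b)"
    using terr sets fin by (intro emeasure_subadditive sets.finite_UN) auto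
  also have "\<dots> \<le> (\<Sum>b\<in>C. emeasure lebesgue (territory \<psi> b))"
    unfolding null add_0 using terr fin by (intro emeasure_subadditive_finite) auto
  also have "\<dots> \<le> (\<Sum>b\<in>C. ennreal \<alpha>)"
    by (intro sum_mono app) (simp add: C_def)
  also have "\<dots> = ennreal (\<alpha> * card C)"
    using \<alpha> by (simp add: ennreal_mult mult.commute ennreal_of_nat_eq_real_of_nat)
  finally show ?thesis using \<alpha> unfolding C_def r_def by (simp add: ennreal_le_iff)
qed

text \<open>Some claimed site \<open>x\<close> lies within \<open>\<rho>\<close> of
  \<open>y\<close>. If its center is farther than \<open>\<rho>\<close> from \<open>x\<close>, the
  volume bound and the cap on \<open>\<alpha>\<close> yield enough centers; otherwise
  \<open>r = \<rho>\<close> and the center itself is the one point required.\<close>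

lemma claimed_closure_crowded:
  fixes \<Xi> :: "'a::euclidean_space set"
  assumes stable: "stable_allocation \<Xi> \<alpha> \<psi>" and lf: "locally_finite_set \<Xi>"
    and \<rho>: "0 < \<rho>" and \<alpha>: "0 < \<alpha>" "\<alpha> \<le> unit_ball_vol DIM('a) * \<rho> ^ DIM('a)"
    and y: "y \<in> claimed_closure \<Xi> \<psi>"
  obtains a r where "crowded \<rho> \<Xi> a r" "y \<in> ball a (2 * r)"
proof -
  obtain x where x: "x \<in> \<psi> -` (Center ` \<Xi>)" "dist x y < \<rho>"
    using y \<rho> unfolding claimed_closure_def closure_approachable by blast
  then obtain a where a: "a \<in> \<Xi>" "x \<in> territory \<psi> a" by (auto simp: territory_def)
  define r where "r = max \<rho> (dist a x)"
  have "0 < r" "\<rho> \<le> r" using \<rho> unfolding r_def by auto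
  have fin: "finite (\<Xi> \<inter> ball a (2 * r))" using lf unfolding locally_finite_set_def by simp
  have "(r / \<rho>) ^ DIM('a) \<le> card (\<Xi> \<inter> ball a (2 * r))"
  proof (cases "dist a x \<le> \<rho>")
    case True
    then have "r = \<rho>" by (simp add: r_def)
    moreover have "a \<in> \<Xi> \<inter> ball a (2 * r)" using a \<open>0 < r\<close> by simp
    then have "card (\<Xi> \<inter> ball a (2 * r)) \<ge> 1"
      using fin by (metis One_nat_def Suc_leI card_gt_0_iff empty_iff)
    ultimately show ?thesis using \<rho> by simp
  next
    case False
    then have r: "r = dist a x" by (simp add: r_def)
    let ?n = "real (card (\<Xi> \<inter> ball a (2 * r)))"
    have "unit_ball_vol DIM('a) * r ^ DIM('a) \<le> \<alpha> * ?n"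
      using stable_ball_volume_le[OF stable lf _ a] \<alpha>(1) unfolding r by simp
    also have "\<dots> \<le> unit_ball_vol DIM('a) * \<rho> ^ DIM('a) * ?n"
      using \<alpha>(2) by (rule mult_right_mono) simp
    finally have "r ^ DIM('a) \<le> \<rho> ^ DIM('a) * ?n"
      using unit_ball_vol_pos[of "DIM('a)"] by (simp add: mult.assoc)
    then show ?thesis using \<rho> by (simp add: power_divide field_simps)
  qed
  then have "crowded \<rho> \<Xi> a r" using \<open>\<rho> \<le> r\<close> by (simp add: crowded_def)
  \<comment> \<open>The doubled radius also absorbs the passage to the closure: \<open>y\<close> is
    within \<open>\<rho>\<close>, hence within \<open>r\<close>, of \<open>x\<close>.\<close>
  moreover have "dist a y < 2 * r"
    using dist_triangle[of a y x] x(2) unfolding r_def by auto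
  ultimately show ?thesis using that by simp
qed

section \<open>From the component of the origin to crowded walks\<close>

text \<open>Serves in place of compactness, since the component of the origin might a priori be
  unbounded. Being joined to \<open>x\<close> by a finite connected subfamily is locally constant: a
  connected set \<open>B i\<close> containing one joined point can be added to the
  subfamily.\<close>

lemma finite_connected_subcover:
  fixes K :: "'a::topological_space set" and B :: "'i \<Rightarrow> 'a set"
  assumes K: "connected K" "x \<in> K" "y \<in> K" "K \<subseteq> (\<Union>i\<in>I. B i)"
    and B: "\<And>i. i \<in> I \<Longrightarrow> open (B i)" "\<And>i. i \<in> I \<Longrightarrow> connected (B i)"
  obtains F where "finite F" "F \<subseteq> I" "connected (\<Union>i\<in>F. B i)"
    "x \<in> (\<Union>i\<in>F. B i)" "y \<in> (\<Union>i\<in>F. B i)"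
proof -
  define Q where "Q z \<longleftrightarrow> (\<exists>F. finite F \<and> F \<subseteq> I \<and> connected (\<Union>i\<in>F. B i) \<and>
    x \<in> (\<Union>i\<in>F. B i) \<and> z \<in> (\<Union>i\<in>F. B i))" for z
  have extend: "Q q" if "Q p" "p \<in> B i" "q \<in> B i" "i \<in> I" for p q i
  proof -
    from \<open>Q p\<close> obtain F where F: "finite F" "F \<subseteq> I" "connected (\<Union>i\<in>F. B i)"
      "x \<in> (\<Union>i\<in>F. B i)" "p \<in> (\<Union>i\<in>F. B i)" unfolding Q_def by blast
    have eq: "(\<Union>i\<in>insert i F. B i) = B i \<union> (\<Union>i\<in>F. B i)" by simp
    have "connected (\<Union>i\<in>insert i F. B i)"
      unfolding eq using F(3,5) that(2) by (intro connected_Un B that) auto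
    then show ?thesis
      unfolding Q_def using F that by (intro exI[of _ "insert i F"]) simp
  qed
  obtain i where i: "i \<in> I" "x \<in> B i" using K(2,4) by blast
  then have "Q x" unfolding Q_def using B(2) by (intro exI[of _ "{i}"]) simp
  with K(1-3) have "Q y"
  proof (rule connected_induction_simple[where P = Q])
    fix z assume z: "z \<in> K"
    then obtain i where i: "i \<in> I" "z \<in> B i" using K(4) by blast
    have "openin (top_of_set K) (K \<inter> B i)" using B(1)[OF i(1)] by (rule openin_open_Int)
    moreover have "z \<in> K \<inter> B i" using z i by simp
    moreover have "\<forall>p\<in>K \<inter> B i. \<forall>q\<in>K \<inter> B i. Q p \<longrightarrow> Q q" using extend i(1) by blast
    ultimately show "\<exists>T. openin (top_of_set K) T \<and> z \<in> T \<and> (\<forall>p\<in>T. \<forall>q\<in>T. Q p \<longrightarrow> Q q)"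
      by blast
  qed
  then show ?thesis using that unfolding Q_def by metis
qed

text \<open>
  By the Vitali covering lemma a disjoint subfamily, whose balls together hold at least
  \<open>\<Sum>(r / \<rho>) ^ d\<close> points, covers everything once its radii are multiplied by five.
\<close>

lemma card_cells_crowded_le:
  fixes \<Xi> :: "'a::euclidean_space set"
  assumes \<rho>: "0 < \<rho>" and lf: "locally_finite_set \<Xi>" and fin: "finite F"
    and crowded: "\<And>a r. (a, r) \<in> F \<Longrightarrow> crowded \<rho> \<Xi> a r"
  defines "A \<equiv> cell \<rho> ` (\<Union>(a, r)\<in>F. ball a (2 * r))"
  shows "finite A" "card A \<le> 23 ^ DIM('a) * card (\<Xi> \<inter> cell \<rho> -` A)"
proof -
  \<comment> \<open>The covering lemma asks for a common bound on the radii. If \<open>F\<close> is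
    empty, the bound holds vacuously.\<close>
  define B where "B = Max ((\<lambda>i. 2 * snd i) ` F)"
  have B: "0 < 2 * snd i \<and> 2 * snd i \<le> B" if "i \<in> F" for i
    using crowded[of "fst i" "snd i"] that \<rho> fin unfolding B_def crowded_def by simp
  obtain C where C: "C \<subseteq> F"
    and disj: "pairwise (\<lambda>i j. disjnt (ball (fst i) (2 * snd i)) (ball (fst j) (2 * snd j))) C"
    and cover: "(\<Union>i\<in>F. ball (fst i) (2 * snd i)) \<subseteq> (\<Union>i\<in>C. ball (fst i) (5 * (2 * snd i)))"
    by (rule Vitali_covering_lemma_balls
        [where K = F and a = fst and r = "\<lambda>i. 2 * snd i", OF subset_refl B])
  have finC: "finite C" using C fin finite_subset by blast
  have cr: "\<rho> \<le> snd i" "(snd i / \<rho>) ^ DIM('a) \<le> card (\<Xi> \<inter> ball (fst i) (2 * snd i))" if "i \<in> C" for i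
    using crowded[of "fst i" "snd i"] that C unfolding crowded_def by auto
  have A_eq: "A = cell \<rho> ` (\<Union>i\<in>F. ball (fst i) (2 * snd i))" unfolding A_def by (simp add: case_prod_beta)
  then have A: "A \<subseteq> (\<Union>i\<in>C. cell \<rho> ` ball (fst i) (10 * snd i))"
    using image_mono[OF cover, of "cell \<rho>"] by (simp add: image_UN)
  have finU: "finite (\<Union>i\<in>C. cell \<rho> ` ball (fst i) (10 * snd i))"
    using finC card_cell_ball_le(1)[OF \<rho>] cr by blast
  then show finA: "finite A" using A finite_subset by blast
  have finN: "finite (\<Xi> \<inter> B)" if "bounded B" for B :: "'a set"
    using lf that unfolding locally_finite_set_def by blast
  have "card A \<le> card (\<Union>i\<in>C. cell \<rho> ` ball (fst i) (10 * snd i))"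
    using A finU by (rule card_mono[rotated])
  also have "\<dots> \<le> (\<Sum>i\<in>C. card (cell \<rho> ` ball (fst i) (10 * snd i)))"
    using finC by (rule card_UN_le)
  finally have "real (card A) \<le> (\<Sum>i\<in>C. real (card (cell \<rho> ` ball (fst i) (10 * snd i))))"
    by (metis of_nat_le_iff of_nat_sum)
  also have "\<dots> \<le> (\<Sum>i\<in>C. 23 ^ DIM('a) * real (card (\<Xi> \<inter> ball (fst i) (2 * snd i))))"
  proof (rule sum_mono)
    fix i assume i: "i \<in> C"
    have "real (card (cell \<rho> ` ball (fst i) (10 * snd i))) \<le> 23 ^ DIM('a) * (snd i / \<rho>) ^ DIM('a)"
      using card_cell_ball_le(2)[OF \<rho> cr(1)[OF i]] .
    also have "\<dots> \<le> 23 ^ DIM('a) * real (card (\<Xi> \<inter> ball (fst i) (2 * snd i)))"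
      using cr(2)[OF i] by (intro mult_left_mono) auto
    finally show "real (card (cell \<rho> ` ball (fst i) (10 * snd i))) \<le> 
      23 ^ DIM('a) * real (card (\<Xi> \<inter> ball (fst i) (2 * snd i)))" .
  qed
  also have "\<dots> = 23 ^ DIM('a) * real (\<Sum>i\<in>C. card (\<Xi> \<inter> ball (fst i) (2 * snd i)))"
    by (simp add: sum_distrib_left)
  also have "(\<Sum>i\<in>C. card (\<Xi> \<inter> ball (fst i) (2 * snd i))) = card (\<Union>i\<in>C. \<Xi> \<inter> ball (fst i) (2 * snd i))"
  proof (rule card_UN_disjoint[symmetric, OF finC])
    show "\<forall>i\<in>C. finite (\<Xi> \<inter> ball (fst i) (2 * snd i))" by (simp add: finN)
    show "\<forall>i\<in>C. \<forall>j\<in>C. i \<noteq> j \<longrightarrow>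
        (\<Xi> \<inter> ball (fst i) (2 * snd i)) \<inter> (\<Xi> \<inter> ball (fst j) (2 * snd j)) = {}"
      using disj unfolding pairwise_def disjnt_def by blast
  qed
  \<comment> \<open>At their original radius the chosen balls belong to the full union, so every
    cell they meet is in \<open>A\<close>. The enlarged balls served only to bound
    \<open>card A\<close>.\<close>
  also have "23 ^ DIM('a) * real \<dots> \<le> 23 ^ DIM('a) * real (card (\<Xi> \<inter> cell \<rho> -` A))"
  proof (intro mult_left_mono of_nat_mono card_mono)
    show "finite (\<Xi> \<inter> cell \<rho> -` A)" by (rule finN[OF cell_preimage_bounded[OF \<rho> finA]])
    show "(\<Union>i\<in>C. \<Xi> \<inter> ball (fst i) (2 * snd i)) \<subseteq> \<Xi> \<inter> cell \<rho> -` A"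
    proof
      fix x assume "x \<in> (\<Union>i\<in>C. \<Xi> \<inter> ball (fst i) (2 * snd i))"
      then have "x \<in> \<Xi>" "x \<in> (\<Union>i\<in>F. ball (fst i) (2 * snd i))" using C by blast+
      then show "x \<in> \<Xi> \<inter> cell \<rho> -` A" unfolding A_eq by blast
    qed
  qed simp
  finally have "real (card A) \<le> real (23 ^ DIM('a) * card (\<Xi> \<inter> cell \<rho> -` A))" by simp
  then show "card A \<le> 23 ^ DIM('a) * card (\<Xi> \<inter> cell \<rho> -` A)" by (simp only: of_nat_le_iff)
qed

text \<open>No allocation appears here, and for fixed \<open>w\<close> only the count in one bounded
  Borel set matters. Hence probabilities are available without any measurability of the
  component.\<close>

definition crowded_walk :: "real \<Rightarrow> 'a::euclidean_space set \<Rightarrow> nat \<Rightarrow> 'a list \<Rightarrow> bool" where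
  "crowded_walk \<rho> \<Xi> k w \<longleftrightarrow> set w \<subseteq> king_steps \<and> length w = 2 * k \<and>
     k + 1 \<le> 23 ^ DIM('a) * card (\<Xi> \<inter> cell \<rho> -` visited 0 w)"

text \<open>A finite connected union of crowded balls joins 0 to \<open>y\<close>, and a walk traces
  the cells it meets. These cells number \<open>k + 1\<close>, so crowding bounds \<open>k\<close>
  by the centers in them, while \<open>y\<close> lies in a cell of the walk and so within a distance
  linear in \<open>k\<close>.\<close>

lemma origin_component_crowded_walk:
  fixes \<rho> :: real and \<Xi> :: "'a::euclidean_space set"
  assumes stable: "stable_allocation \<Xi> \<alpha> \<psi>" and lf: "locally_finite_set \<Xi>"
    and \<rho>: "0 < \<rho>" and \<alpha>: "0 < \<alpha>" "\<alpha> \<le> unit_ball_vol DIM('a) * \<rho> ^ DIM('a)"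
    and y: "y \<in> origin_component \<Xi> \<psi>"
  obtains k w where "crowded_walk \<rho> \<Xi> k w" "norm y \<le> 2 * DIM('a) * \<rho> * real (k + 1)"
proof -
  let ?K = "origin_component \<Xi> \<psi>"
  have K: "connected ?K" "0 \<in> ?K" "?K \<subseteq> claimed_closure \<Xi> \<psi>"
    using y connected_component_subset[of "claimed_closure \<Xi> \<psi>" 0]
      connected_component_in[of "claimed_closure \<Xi> \<psi>" 0 y]
    unfolding origin_component_def by (auto simp: connected_component_refl)
  let ?I = "{(a, r). crowded \<rho> \<Xi> a r}" and ?B = "\<lambda>(a, r). ball a (2 * r) :: 'a set"
  have "?K \<subseteq> (\<Union>i\<in>?I. ?B i)"
  proof
    fix z assume "z \<in> ?K"
    with K(3) have "z \<in> claimed_closure \<Xi> \<psi>" by (rule subsetD)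
    then obtain a r where "crowded \<rho> \<Xi> a r" "z \<in> ball a (2 * r)"
      by (rule claimed_closure_crowded[OF stable lf \<rho> \<alpha>])
    then show "z \<in> (\<Union>i\<in>?I. ?B i)" by blast
  qed
  then obtain F where F: "finite F" "F \<subseteq> ?I" "connected (\<Union>i\<in>F. ?B i)"
    "0 \<in> (\<Union>i\<in>F. ?B i)" "y \<in> (\<Union>i\<in>F. ?B i)"
    by (rule finite_connected_subcover[OF K(1,2) y]) (auto intro: that)
  define U where "U = (\<Union>(a, r)\<in>F. ball a (2 * r))"
  have U: "connected U" "0 \<in> U" "y \<in> U" using F(3-5) by (simp_all only: U_def)
  have A: "finite (cell \<rho> ` U)" "card (cell \<rho> ` U) \<le> 23 ^ DIM('a) * card (\<Xi> \<inter> cell \<rho> -` cell \<rho> ` U)"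
    unfolding U_def by (rule card_cells_crowded_le[OF \<rho> lf F(1)], use F(2) in blast)+
  define k where "k = card (cell \<rho> ` U) - 1"
  have "card (cell \<rho> ` U) > 0" using A(1) U(2) by (auto simp: card_gt_0_iff)
  then have k: "k + 1 = card (cell \<rho> ` U)" by (simp add: k_def)
  obtain w where w: "set w \<subseteq> king_steps" "length w = 2 * k" "visited 0 w = cell \<rho> ` U"
    unfolding k_def by (rule walk_visiting_cells[OF \<rho> U(1,2) A(1)])
  \<comment> \<open>A walk of \<open>2 * k\<close> steps moves each coordinate by at most
    \<open>2 * k\<close>, and undoing the floor adds at most 1.\<close>
  have "\<bar>y \<bullet> b\<bar> \<le> 2 * \<rho> * (k + 1)" if b: "b \<in> Basis" for b
  proof -
    have "cell \<rho> y \<in> visited 0 w" using U(3) unfolding w(3) by blast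
    from visited_coordinate_bound[OF w(1) this b]
    have "\<bar>real_of_int \<lfloor>y \<bullet> b / \<rho>\<rfloor>\<bar> \<le> 2 * k" using w(2) cell_inner[OF b, of \<rho> y] by simp
    then have "\<bar>y \<bullet> b / \<rho>\<bar> \<le> 2 * (k + 1)" by simp linarith
    then show ?thesis using \<rho> by (simp add: abs_divide field_simps)
  qed
  then have "(\<Sum>b\<in>Basis. \<bar>y \<bullet> b\<bar>) \<le> DIM('a) * (2 * \<rho> * (k + 1))"
    by (rule sum_bounded_above)
  then have "norm y \<le> 2 * DIM('a) * \<rho> * real (k + 1)"
    using norm_le_l1[of y] by (simp add: mult_ac)
  moreover have "crowded_walk \<rho> \<Xi> k w"
    unfolding crowded_walk_def using w A(2) k by simp
  ultimately show ?thesis by (rule that[rotated])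
qed

subsection \<open>Probability of crowded walks\<close>

text \<open>Chernoff's bound, with \<open>v = exp (t / c)\<close> for the usual parameter \<open>t\<close>.\<close>

lemma (in prob_space) poisson_upper_tail:
  fixes N :: "'a \<Rightarrow> nat" and \<mu> v :: real
  assumes N: "N \<in> measurable M (count_space UNIV)"
    and poisson: "\<And>n. prob {\<omega> \<in> space M. N \<omega> = n} = \<mu> ^ n / fact n * exp (- \<mu>)"
    and \<mu>: "0 \<le> \<mu>" and v: "1 \<le> v"
  shows "prob {\<omega> \<in> space M. j \<le> c * N \<omega>} \<le> exp (\<mu> * (v ^ c - 1)) / v ^ j"
proof -
  define A where "A n = {\<omega> \<in> space M. N \<omega> = n \<and> j \<le> c * N \<omega>}" for n
  note N[measurable]
  have "(\<lambda>n. prob (A n)) sums prob (\<Union>n. A n)"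
    unfolding A_def by (rule finite_measure_UNION) (auto simp: disjoint_family_on_def)
  moreover have "(\<Union>n. A n) = {\<omega> \<in> space M. j \<le> c * N \<omega>}" by (auto simp: A_def)
  ultimately have 1: "(\<lambda>n. prob (A n)) sums prob {\<omega> \<in> space M. j \<le> c * N \<omega>}" by simp
  \<comment> \<open>This series is the mean of \<open>v ^ (c * N)\<close> divided by
    \<open>v ^ j\<close>, split by the value of \<open>N\<close>. Comparing it term by term with the
    first series is Markov's inequality.\<close>
  have "(\<lambda>n. exp (- \<mu>) / v ^ j * ((\<mu> * v ^ c) ^ n /\<^sub>R fact n)) sums (exp (- \<mu>) / v ^ j * exp (\<mu> * v ^ c))"
    by (intro sums_mult exp_converges)
  also have "exp (- \<mu>) / v ^ j * exp (\<mu> * v ^ c) = exp (\<mu> * (v ^ c - 1)) / v ^ j"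
    by (simp add: mult_exp_exp right_diff_distrib)
  finally have 2: "(\<lambda>n. exp (- \<mu>) / v ^ j * ((\<mu> * v ^ c) ^ n /\<^sub>R fact n)) sums (exp (\<mu> * (v ^ c - 1)) / v ^ j)" .
  have "prob (A n) \<le> exp (- \<mu>) / v ^ j * ((\<mu> * v ^ c) ^ n /\<^sub>R fact n)" for n
  proof (cases "j \<le> c * n")
    case True
    then have "A n = {\<omega> \<in> space M. N \<omega> = n}" by (auto simp: A_def)
    then have "prob (A n) = exp (- \<mu>) / v ^ j * (\<mu> ^ n * v ^ j /\<^sub>R fact n)"
      using v poisson[of n] by (simp add: divide_inverse)
    also have "v ^ j \<le> (v ^ c) ^ n" using v True by (simp add: power_mult[symmetric] power_increasing)
    then have "exp (- \<mu>) / v ^ j * (\<mu> ^ n * v ^ j /\<^sub>R fact n) \<le> exp (- \<mu>) / v ^ j * (\<mu> ^ n * (v ^ c) ^ n /\<^sub>R fact n)"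
      using v \<mu> by (intro mult_left_mono scaleR_left_mono) auto
    finally show ?thesis by (simp add: power_mult_distrib)
  next
    case False
    then have "A n = {}" by (auto simp: A_def)
    then show ?thesis using v \<mu> by (simp add: scaleR_conv_of_real)
  qed
  then show ?thesis by (rule sums_le[OF _ 1 2])
qed

lemma poisson_point_process_count:
  assumes "poisson_point_process M X" "B \<in> sets borel" "bounded B"
  shows "(\<lambda>\<omega>. card (X \<omega> \<inter> B)) \<in> measurable M (count_space UNIV)"
    and "measure M {\<omega> \<in> space M. card (X \<omega> \<inter> B) = n} =
      measure lborel B ^ n / fact n * exp (- measure lborel B)"
  using assms by (simp_all add: poisson_point_process_def)

lemma crowded_walk_event_measurable:
  fixes X :: "'w \<Rightarrow> 'a::euclidean_space set"
  assumes ppp: "poisson_point_process M X" and \<rho>: "0 < \<rho>"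
  shows "{\<omega> \<in> space M. crowded_walk \<rho> (X \<omega>) k w} \<in> sets M"
proof -
  note [measurable] = poisson_point_process_count(1)[OF ppp
      cell_preimage_measurable[OF finite_visited] cell_preimage_bounded[OF \<rho> finite_visited]]
  show ?thesis unfolding crowded_walk_def by measurable
qed

definition crowded_event :: "'w measure \<Rightarrow> ('w \<Rightarrow> 'a::euclidean_space set) \<Rightarrow> real \<Rightarrow> nat \<Rightarrow> 'w set" where
  "crowded_event M X \<rho> k = {\<omega> \<in> space M. \<exists>w. crowded_walk \<rho> (X \<omega>) k w}"

text \<open>As a finite union over walks, the event is measurable and open to a union bound.\<close>

lemma crowded_event_eq:
  "crowded_event M X \<rho> k =
    (\<Union>w\<in>{w. set w \<subseteq> king_steps \<and> length w = 2 * k}. {\<omega> \<in> space M. crowded_walk \<rho> (X \<omega>) k w})"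
  by (auto simp: crowded_event_def crowded_walk_def)

lemma crowded_event_sets:
  fixes X :: "'w \<Rightarrow> 'a::euclidean_space set"
  assumes "poisson_point_process M X" "0 < \<rho>"
  shows "crowded_event M X \<rho> k \<in> sets M"
  unfolding crowded_event_eq
  by (intro sets.finite_UN finite_lists_length_eq finite_king_steps crowded_walk_event_measurable[OF assms])

text \<open>
  Peierls' argument: the tail parameter beats the number \<open>K ^ (2 * k)\<close> of walks, after which \<open>\<rho>\<close>
  is taken so small that the exponential moment contributes at most a factor 2 per cell.
\<close>

lemma crowded_event_prob_le:
  obtains \<rho> where "0 < \<rho>"
    "\<And>(M :: 'w measure) (X :: 'w \<Rightarrow> 'a::euclidean_space set) k.
       poisson_point_process M X \<Longrightarrow> measure M (crowded_event M X \<rho> k) \<le> (1 / 2) ^ (k + 1)"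
proof -
  define K where "K = card (king_steps :: 'a set)"
  define c :: nat where "c = 23 ^ DIM('a)"
  \<comment> \<open>Per cell there is a factor \<open>K ^ 2\<close> for the choice of two steps and
    a factor 2 for the exponential moment; dividing by this \<open>v\<close> leaves
    \<open>1 / 2\<close>.\<close>
  define v :: real where "v = 4 * real K ^ 2"
  \<comment> \<open>The volume of one cell. A walk of length \<open>2 * k\<close> visits at most
    \<open>2 * (k + 1)\<close> cells, so \<open>\<mu> * v ^ c\<close> is at most
    \<open>(k + 1) * ln 2\<close>.\<close>
  define e :: real where "e = ln 2 / (2 * v ^ c)"
  define \<rho> where "\<rho> = root DIM('a) e"
  have "K > 0" unfolding K_def using zero_king_step finite_king_steps by (auto simp: card_gt_0_iff)
  then have K1: "real K \<ge> 1" by simp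
  then have v: "1 \<le> v" unfolding v_def using one_le_power[of "real K" 2] by linarith
  then have "v > 0" "v ^ c > 0" by simp_all
  then have "e > 0" unfolding e_def by simp
  then have \<rho>: "0 < \<rho>" "\<rho> ^ DIM('a) = e" unfolding \<rho>_def by simp_all
  have "measure M (crowded_event M X \<rho> k) \<le> (1 / 2) ^ (k + 1)"
    if ppp: "poisson_point_process M X" for M :: "'w measure" and X :: "'w \<Rightarrow> 'a set" and k
  proof -
    interpret prob_space M using ppp by (simp add: poisson_point_process_def)
    let ?W = "{w :: 'a list. set w \<subseteq> king_steps \<and> length w = 2 * k}"
    have one: "prob {\<omega> \<in> space M. crowded_walk \<rho> (X \<omega>) k w} \<le> 2 ^ (k + 1) / v ^ (k + 1)"
      if w: "w \<in> ?W" for w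
    proof -
      let ?B = "cell \<rho> -` visited 0 w"
      have B: "?B \<in> sets borel" "bounded ?B"
        by (simp_all add: cell_preimage_measurable cell_preimage_bounded \<rho> finite_visited)
      define \<mu> where "\<mu> = measure lborel ?B"
      have "\<mu> \<le> card (visited 0 w) * e"
        using measure_cell_preimage_le[OF \<rho>(1) finite_visited, of 0 w] unfolding \<mu>_def \<rho>(2) .
      also have "\<dots> \<le> (2 * (k + 1)) * e"
        using card_visited_le[of 0 w] w \<open>e > 0\<close> by (intro mult_right_mono) (auto simp del: of_nat_add of_nat_mult)
      finally have "\<mu> * (v ^ c - 1) \<le> (2 * (k + 1)) * e * v ^ c"
        using v \<open>e > 0\<close> by (intro mult_mono) (auto simp: one_le_power)
      also have "\<dots> = (k + 1) * ln 2" using \<open>v > 0\<close> by (simp add: e_def)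
      finally have "exp (\<mu> * (v ^ c - 1)) \<le> exp ((k + 1) * ln 2)" by simp
      also have "\<dots> = 2 ^ (k + 1)" by (subst exp_of_nat_mult) simp
      finally have exp_le: "exp (\<mu> * (v ^ c - 1)) \<le> 2 ^ (k + 1)" .
      have "prob {\<omega> \<in> space M. crowded_walk \<rho> (X \<omega>) k w} =
          prob {\<omega> \<in> space M. k + 1 \<le> c * card (X \<omega> \<inter> ?B)}"
        using w by (simp add: crowded_walk_def c_def)
      also have "\<dots> \<le> exp (\<mu> * (v ^ c - 1)) / v ^ (k + 1)"
      proof (rule poisson_upper_tail[OF _ _ _ v])
        show "(\<lambda>\<omega>. card (X \<omega> \<inter> ?B)) \<in> measurable M (count_space UNIV)"
          by (rule poisson_point_process_count(1)[OF ppp B])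
        show "prob {\<omega> \<in> space M. card (X \<omega> \<inter> ?B) = n} = \<mu> ^ n / fact n * exp (- \<mu>)" for n
          unfolding \<mu>_def by (rule poisson_point_process_count(2)[OF ppp B])
        show "0 \<le> \<mu>" by (simp add: \<mu>_def)
      qed
      also have "\<dots> \<le> 2 ^ (k + 1) / v ^ (k + 1)"
        using exp_le v by (intro divide_right_mono) auto
      finally show ?thesis .
    qed
    have "prob (crowded_event M X \<rho> k) \<le> (\<Sum>w\<in>?W. prob {\<omega> \<in> space M. crowded_walk \<rho> (X \<omega>) k w})"
      unfolding crowded_event_eq
      by (intro measure_UNION_le finite_lists_length_eq finite_king_steps
          crowded_walk_event_measurable[OF ppp \<rho>(1)])
    also have "\<dots> \<le> card ?W * (2 ^ (k + 1) / v ^ (k + 1))"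
      using one by (rule sum_bounded_above)
    also have "card ?W = K ^ (2 * k)"
      unfolding K_def by (rule card_lists_length_eq[OF finite_king_steps])
    \<comment> \<open>Raising the exponent to \<open>2 * (k + 1)\<close> costs a constant factor and
      makes the bound a pure power.\<close>
    also have "real (K ^ (2 * k)) * (2 ^ (k + 1) / v ^ (k + 1)) \<le> real K ^ (2 * (k + 1)) * (2 ^ (k + 1) / v ^ (k + 1))"
      using K1 v unfolding of_nat_power by (intro mult_right_mono power_increasing) auto
    also have "\<dots> = (real K ^ 2 * (2 / v)) ^ (k + 1)"
      by (simp only: power_mult power_mult_distrib power_divide of_nat_power)
    also have "real K ^ 2 * (2 / v) = 1 / 2" using K1 by (simp add: v_def)
    finally show ?thesis .
  qed
  then show ?thesis by (rule that[OF \<rho>(1)])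
qed

section \<open>Moments of the diameter\<close>

text \<open>The power of \<open>k\<close> is absorbed by passing from ratio \<open>1 / 2\<close> to
  \<open>3 / 4\<close>; any ratio strictly between \<open>1 / 2\<close> and 1 would do.\<close>

lemma summable_moment_geometric:
  fixes D s :: real
  assumes "0 < D"
  shows "summable (\<lambda>k. (D * real (k + 1)) powr s * (1 / 2) ^ (k + 1))"
proof (rule summable_comparison_test_bigo)
  show "summable (\<lambda>k. norm ((3 / 4 :: real) ^ k))" by (simp add: summable_geometric)
  show "(\<lambda>k. (D * real (k + 1)) powr s * (1 / 2) ^ (k + 1)) \<in> O(\<lambda>k. (3 / 4) ^ k)"
    using assms by real_asymp
qed

text \<open>Provides the integrable majorant: almost surely the series is a finite sum, and its
  expectation is taken term by term.\<close>

lemma integrable_indicator_series: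
  fixes f :: "nat \<Rightarrow> real"
  assumes "prob_space M" and A: "\<And>k. A k \<in> sets M" and f: "\<And>k. 0 \<le> f k"
    and fin: "AE \<omega> in M. eventually (\<lambda>k. \<omega> \<notin> A k) sequentially"
    and sum: "summable (\<lambda>k. f k * measure M (A k))"
  shows "integrable M (\<lambda>\<omega>. \<Sum>k. f k * indicator (A k) \<omega>)"
proof (rule integrable_suminf)
  interpret prob_space M by fact
  show "integrable M (\<lambda>\<omega>. f k * indicator (A k) \<omega>)" for k
    using A by (simp add: emeasure_eq_measure)
  show "AE \<omega> in M. summable (\<lambda>k. norm (f k * indicator (A k) \<omega> :: real))"
    using fin
  proof eventually_elim
    case (elim \<omega>)
    then obtain n where "\<forall>k\<ge>n. \<omega> \<notin> A k" unfolding eventually_sequentially by blast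
    then show ?case by (intro summable_finite[of "{..<n}"]) (auto simp: not_less)
  qed
  show "summable (\<lambda>k. LINT \<omega>|M. norm (f k * indicator (A k) \<omega> :: real))"
    using sum A f by (simp add: abs_mult sets.Int_space_eq2)
qed

text \<open>Boundedness accompanies the moment bound because \<open>diameter\<close> is meaningful
  on bounded sets. The exceptional null set is common to all \<open>\<psi>\<close>.\<close>

theorem theorem1p10:
  fixes M :: "'w measure" and X :: "'w \<Rightarrow> 'a::euclidean_space set"
  assumes "poisson_point_process M X"
  shows "\<exists>\<alpha>\<^sub>0>0. \<forall>\<alpha>. 0 < \<alpha> \<and> \<alpha> < \<alpha>\<^sub>0 \<longrightarrow>
           (\<forall>s::real. s > 0 \<longrightarrow>
             (\<exists>Y :: 'w \<Rightarrow> real. integrable M Y \<and>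
               (AE \<omega> in M. \<forall>\<psi>. stable_allocation (X \<omega>) \<alpha> \<psi> \<longrightarrow>
                  bounded (origin_component (X \<omega>) \<psi>) \<and>
                  diameter (origin_component (X \<omega>) \<psi>) powr s \<le> Y \<omega>)))"
proof -
  interpret prob_space M using assms by (simp add: poisson_point_process_def)
  obtain \<rho> where \<rho>: "0 < \<rho>"
    and bound: "\<And>(M :: 'w measure) (X :: 'w \<Rightarrow> 'a set) k.
      poisson_point_process M X \<Longrightarrow> measure M (crowded_event M X \<rho> k) \<le> (1 / 2) ^ (k + 1)"
    by (rule crowded_event_prob_le) (rule that)
  note prob_le = bound[OF assms]
  let ?A = "crowded_event M X \<rho>"
  \<comment> \<open>Twice the constant of the norm bound, as a diameter is at most twice a radius
    about the origin.\<close>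
  define D where "D = 2 * (2 * DIM('a) * \<rho>)"
  have D: "0 < D" using \<rho> by (simp add: D_def)
  have A: "?A k \<in> sets M" for k using crowded_event_sets[OF assms \<rho>] .
  have "summable (\<lambda>k. (1 / 2 :: real) ^ (k + 1))"
    by (rule summable_ignore_initial_segment) (simp add: summable_geometric)
  then have "summable (\<lambda>k. prob (?A k))"
    by (rule summable_comparison_test'[where N = 0]) (use prob_le in auto)
  \<comment> \<open>Borel-Cantelli: almost surely only finitely many of the crowded events
    occur.\<close>
  then have "AE \<omega> in M. eventually (\<lambda>k. \<omega> \<in> space M - ?A k) sequentially"
    by (intro borel_cantelli_AE1 A) (simp_all add: emeasure_eq_measure)
  then have fin: "AE \<omega> in M. eventually (\<lambda>k. \<omega> \<notin> ?A k) sequentially"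
    by eventually_elim (erule eventually_mono, blast)
  \<comment> \<open>The threshold is the volume of a ball of radius \<open>\<rho>\<close>, fixed
    before \<open>s\<close> is chosen.\<close>
  show ?thesis
  proof (rule exI[of _ "unit_ball_vol DIM('a) * \<rho> ^ DIM('a)"], intro conjI allI impI)
    show "0 < unit_ball_vol DIM('a) * \<rho> ^ DIM('a)" using \<rho> by simp
    fix \<alpha> s :: real
    assume "0 < \<alpha> \<and> \<alpha> < unit_ball_vol DIM('a) * \<rho> ^ DIM('a)" and s: "0 < s"
    then have \<alpha>: "0 < \<alpha>" "\<alpha> < unit_ball_vol DIM('a) * \<rho> ^ DIM('a)" by simp_all
    define f where "f k = (D * real (k + 1)) powr s" for k
    \<comment> \<open>\<open>f k\<close> bounds the moment when \<open>k\<close> is the last crowded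
      event to occur; the sum dominates it whichever \<open>k\<close> that is.\<close>
    define Y where "Y \<omega> = (\<Sum>k. f k * indicator (?A k) \<omega>)" for \<omega>
    have f: "0 \<le> f k" for k by (simp add: f_def)
    have "summable (\<lambda>k. f k * prob (?A k))"
    proof (rule summable_comparison_test'[OF summable_moment_geometric[OF D, of s], where N = 0])
      fix k
      have "norm (f k * prob (?A k)) = f k * prob (?A k)" using f by simp
      also have "\<dots> \<le> f k * (1 / 2) ^ (k + 1)" by (rule mult_left_mono[OF prob_le f])
      finally show "norm (f k * prob (?A k)) \<le> (D * real (k + 1)) powr s * (1 / 2) ^ (k + 1)"
        unfolding f_def .
    qed
    then have int: "integrable M Y"
      unfolding Y_def by (intro integrable_indicator_series prob_space_axioms A f fin)
    have "AE \<omega> in M. \<forall>\<psi>. stable_allocation (X \<omega>) \<alpha> \<psi> \<longrightarrow>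
      bounded (origin_component (X \<omega>) \<psi>) \<and> diameter (origin_component (X \<omega>) \<psi>) powr s \<le> Y \<omega>"
      using fin AE_space
    proof eventually_elim
      case (elim \<omega>)
      then obtain n where "\<forall>k\<ge>n. \<omega> \<notin> ?A k" unfolding eventually_sequentially by blast
      then have n: "k < n" if "\<omega> \<in> ?A k" for k using that by (meson not_less)
      have lf: "locally_finite_set (X \<omega>)" using assms elim(2) by (simp add: poisson_point_process_def)
      have summ: "summable (\<lambda>k. f k * indicator (?A k) \<omega>)"
        using n by (intro summable_finite[of "{..<n}"]) (auto simp: indicator_def)
      have Y_ge: "f k \<le> Y \<omega>" if "\<omega> \<in> ?A k" for k
      proof -
        have "f k = (\<Sum>i\<in>{k}. f i * indicator (?A i) \<omega>)" using that by simp
        also have "\<dots> \<le> Y \<omega>" unfolding Y_def by (rule sum_le_suminf[OF summ]) (simp_all add: f)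
        finally show ?thesis .
      qed
      show ?case
      proof (intro allI impI)
        fix \<psi> assume stable: "stable_allocation (X \<omega>) \<alpha> \<psi>"
        let ?K = "origin_component (X \<omega>) \<psi>"
        have walk: "\<exists>k. \<omega> \<in> ?A k \<and> norm y \<le> D / 2 * real (k + 1)" if y: "y \<in> ?K" for y
        proof -
          obtain k w where "crowded_walk \<rho> (X \<omega>) k w" "norm y \<le> 2 * DIM('a) * \<rho> * real (k + 1)"
            by (rule origin_component_crowded_walk[OF stable lf \<rho> \<alpha>(1) less_imp_le[OF \<alpha>(2)] y])
          then have "\<omega> \<in> ?A k" "norm y \<le> D / 2 * real (k + 1)"
            using elim(2) by (auto simp: crowded_event_def D_def mult_ac)
          then show ?thesis by blast
        qed
        show "bounded ?K \<and> diameter ?K powr s \<le> Y \<omega>"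
        proof (cases "?K = {}")
          \<comment> \<open>The origin is outside the closure: the diameter is 0, and
            \<open>0 powr s\<close> is 0.\<close>
          case True
          have "0 \<le> Y \<omega>" unfolding Y_def by (rule suminf_nonneg[OF summ]) (simp add: f)
          then show ?thesis using True by simp
        next
          case False
          then have nonempty: "{k. \<omega> \<in> ?A k} \<noteq> {}" using walk by blast
          have finite: "finite {k. \<omega> \<in> ?A k}"
            using n by (intro finite_subset[OF _ finite_lessThan[of n]]) blast
          \<comment> \<open>Different points \<open>y\<close> may come with different walks, so the
            largest index serves them all.\<close>
          define m where "m = Max {k. \<omega> \<in> ?A k}"
          have m: "\<omega> \<in> ?A m" using Max_in[OF finite nonempty] by (simp add: m_def)
          have norm_le: "norm y \<le> D / 2 * real (m + 1)" if y: "y \<in> ?K" for y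
          proof -
            obtain k where k: "\<omega> \<in> ?A k" "norm y \<le> D / 2 * real (k + 1)" using walk[OF y] by blast
            have "k \<le> m" unfolding m_def using k(1) finite by (intro Max_ge) auto
            then have "D / 2 * real (k + 1) \<le> D / 2 * real (m + 1)"
              using D by (intro mult_left_mono) auto
            then show ?thesis using k(2) by simp
          qed
          then have bdd: "bounded ?K" unfolding bounded_iff by blast
          have "diameter ?K \<le> D * real (m + 1)"
          proof (rule diameter_le)
            show "?K \<noteq> {} \<or> 0 \<le> D * real (m + 1)" using False by simp
            fix y z assume "y \<in> ?K" "z \<in> ?K"
            then show "norm (y - z) \<le> D * real (m + 1)"
              using norm_le[of y] norm_le[of z] norm_triangle_ineq4[of y z] by simp
          qed
          then have "diameter ?K powr s \<le> f m"
            unfolding f_def using s bdd by (intro powr_mono2) (auto simp: diameter_ge_0)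
          then show ?thesis using bdd Y_ge[OF m] by simp
        qed
      qed
    qed
    then show "\<exists>Y. integrable M Y \<and> (AE \<omega> in M. \<forall>\<psi>. stable_allocation (X \<omega>) \<alpha> \<psi> \<longrightarrow>
      bounded (origin_component (X \<omega>) \<psi>) \<and> diameter (origin_component (X \<omega>) \<psi>) powr s \<le> Y \<omega>)"
      using int by blast
  qed
qed

end
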